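(* For $n\ge3$ let $C_n$ be the cyclic graph with vertices $v_1,\dots,v_n$ and edges $[v_1,v_2],\dots,[v_{n-1},v_n],[v_n,v_1]$. Then the sequence $x_n=P(C_n)$, $n\ge3$, satisfies the linear recurrence relation $$x_{n+2}-\frac34x_{n+1}+\frac1{16}x_n=0$$ with initial conditions $$P(C_3)=\frac{9}{32},\qquad P(C_4)=\frac{47}{256}.$$ In particular, $h(C_n)\sim\log r$ as $n\to\infty$, where $r=\frac{3+\sqrt5}{8}$.
   Context: Let $\Gamma$ be a finite graph without loops or multiple edges, with vertex set $V(\Gamma)$, edge set $E(\Gamma)$, and $N_\Gamma=|E(\Gamma)|$. Let $I_\Gamma\subset V(\Gamma)\times E(\Gamma)$ be the set of pairs $(v,e)$ with $v$ an endpoint of $e$ (so $|I_\Gamma|=2N_\Gamma$). An orientation prescription is a function $\omega:I_\Gamma\to\{\pm1\}$; it orients each edge of the barycentric subdivision of $\Gamma$ (whose edges join a vertex $v$ to the midpoint $b_e$ of an incident edge $e$): the edge is oriented $b_e\to v$ if $\omega(v,e)=1$, and $v\to b_e$ if $\omega(v,e)=-1$. The prescription $\omega$ is a combinatorial flow if every vertex $v\in V(\Gamma)$ has at most one outgoing edge and every midpoint $b_e$ has at most one incoming edge; equivalently, for each $v$ there is at most one $e$ with $\omega(v,e)=-1$, and for each $e$ there is at most one $v$ with $\omega(v,e)=-1$. Let $P(\Gamma)$ be the probability that a uniformly random orientation prescription is a combinatorial flow, i.e. $P(\Gamma)=4^{-N_\Gamma}\cdot\#\{\text{combinatorial flows on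 }\Gamma\}$. Define $h(\Gamma)=\frac{\log P(\Gamma)}{N_\Gamma}$ if $E(\Gamma)\ne\emptyset$ and $h(\Gamma)=0$ otherwise. The notation $a_n\sim a$ for a nonzero constant $a$ means $a_n/a\to1$, i.e. $a_n\to a$. *)

theory Defs
  imports "HOL-Probability.Probability" "HOL-Library.Landau_Symbols"
begin

record 'a ugraph =
  verts :: "'a set"
  edges :: "'a set set"

text \<open>Edges are two-element sets of vertices, so there are no loops and no multiple edges.\<close>

definition finite_simple_graph :: "'a ugraph \<Rightarrow> bool" where
  "finite_simple_graph G \<longleftrightarrow>
     finite (verts G) \<and> (\<forall>e \<in> edges G. e \<subseteq> verts G \<and> card e = 2)"

definition incidences :: "'a ugraph \<Rightarrow> ('a \<times> 'a set) set" where
  "incidences G = {(v, e). v \<in> verts G \<and> e \<in> edges G \<and> v \<in> e}"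

text \<open>
  The functions are extensional, so that each function on the incidences is counted once.
\<close>

definition orientation_prescriptions :: "'a ugraph \<Rightarrow> ('a \<times> 'a set \<Rightarrow> int) set" where
  "orientation_prescriptions G = incidences G \<rightarrow>\<^sub>E {1, -1}"

text \<open>The vertices of the barycentric subdivision: original vertices and edge midpoints.\<close>

datatype 'a bary = Vertex 'a | Midpoint "'a set"

definition bary_arcs ::
    "'a ugraph \<Rightarrow> ('a \<times> 'a set \<Rightarrow> int) \<Rightarrow> ('a bary \<times> 'a bary) set" where
  "bary_arcs G \<omega> =
     {(Midpoint e, Vertex v) | v e. (v, e) \<in> incidences G \<and> \<omega> (v, e) = 1} \<union>
     {(Vertex v, Midpoint e) | v e. (v, e) \<in> incidences G \<and> \<omega> (v, e) = -1}"

definition combinatorial_flow :: "'a ugraph \<Rightarrow> ('a \<times> 'a set \<Rightarrow> int) \<Rightarrow> bool" where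
  "combinatorial_flow G \<omega> \<longleftrightarrow>
     (\<forall>v \<in> verts G. \<exists>\<^sub>\<le>\<^sub>1 y. (Vertex v, y) \<in> bary_arcs G \<omega>) \<and>
     (\<forall>e \<in> edges G. \<exists>\<^sub>\<le>\<^sub>1 y. (y, Midpoint e) \<in> bary_arcs G \<omega>)"

definition flow_prob :: "'a ugraph \<Rightarrow> real" where
  "flow_prob G =
     measure_pmf.prob (pmf_of_set (orientation_prescriptions G)) {\<omega>. combinatorial_flow G \<omega>}"

definition flow_entropy :: "'a ugraph \<Rightarrow> real" where
  "flow_entropy G =
     (if edges G \<noteq> {} then ln (flow_prob G) / real (card (edges G)) else 0)"

text \<open>The vertex $v_i$ is the number $i$. For $n < 3$ this is not a cycle.\<close>

definition cycle_graph :: "nat \<Rightarrow> nat ugraph" where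
  "cycle_graph n =
     \<lparr>verts = {1..n}, edges = {{i, i + 1} | i. 1 \<le> i \<and> i < n} \<union> {{n, 1}}\<rparr>"

lemma combinatorial_flow_iff:
  "combinatorial_flow G \<omega> \<longleftrightarrow>
     (\<forall>v \<in> verts G. \<exists>\<^sub>\<le>\<^sub>1 e. (v, e) \<in> incidences G \<and> \<omega> (v, e) = -1) \<and>
     (\<forall>e \<in> edges G. \<exists>\<^sub>\<le>\<^sub>1 v. (v, e) \<in> incidences G \<and> \<omega> (v, e) = -1)"
proof -
  have "(\<exists>\<^sub>\<le>\<^sub>1 y. (Vertex v, y) \<in> bary_arcs G \<omega>) \<longleftrightarrow>
        (\<exists>\<^sub>\<le>\<^sub>1 e. (v, e) \<in> incidences G \<and> \<omega> (v, e) = -1)" for v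
    unfolding Uniq_def bary_arcs_def by auto
  moreover have "(\<exists>\<^sub>\<le>\<^sub>1 y. (y, Midpoint e) \<in> bary_arcs G \<omega>) \<longleftrightarrow>
        (\<exists>\<^sub>\<le>\<^sub>1 v. (v, e) \<in> incidences G \<and> \<omega> (v, e) = -1)" for e
    unfolding Uniq_def bary_arcs_def by auto
  ultimately show ?thesis
    unfolding combinatorial_flow_def by simp
qed

lemma finite_edges: "finite_simple_graph G \<Longrightarrow> finite (edges G)"
  unfolding finite_simple_graph_def by (meson Pow_iff finite_Pow_iff finite_subset subsetI)

lemma incidences_card:
  assumes "finite_simple_graph G"
  shows "finite (incidences G)" "card (incidences G) = 2 * card (edges G)"
proof -
  have eq: "incidences G = prod.swap ` (SIGMA e:edges G. e)"
    using assms unfolding incidences_def finite_simple_graph_def by (fastforce simp: image_iff)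
  have fin: "finite (edges G)" "\<And>e. e \<in> edges G \<Longrightarrow> finite e"
    using assms finite_edges[OF assms] unfolding finite_simple_graph_def
    by (auto intro: finite_subset)
  show "finite (incidences G)"
    unfolding eq using fin by auto
  have "card (incidences G) = (\<Sum>e\<in>edges G. card e)"
    unfolding eq using fin by (simp add: card_image)
  also have "\<dots> = (\<Sum>e\<in>edges G. 2)"
    using assms unfolding finite_simple_graph_def by (intro sum.cong) auto
  finally show "card (incidences G) = 2 * card (edges G)"
    by simp
qed

lemma flow_prob_eq_card:
  assumes "finite_simple_graph G"
  shows "flow_prob G =
    real (card {\<omega> \<in> orientation_prescriptions G. combinatorial_flow G \<omega>}) / 4 ^ card (edges G)"
proof -
  note inc = incidences_card[OF assms]
  have fin: "finite (orientation_prescriptions G)"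
    unfolding orientation_prescriptions_def using inc(1) by (intro finite_PiE) auto
  have card: "card (orientation_prescriptions G) = 4 ^ card (edges G)"
    unfolding orientation_prescriptions_def using inc
    by (simp add: card_PiE power_mult card_insert_if flip: numeral_2_eq_2)
  then have "orientation_prescriptions G \<noteq> {}"
    by auto
  then show ?thesis
    unfolding flow_prob_def using fin card
    by (simp add: measure_pmf_of_set Int_def)
qed

lemma finite_simple_cycle_graph: "n \<ge> 3 \<Longrightarrow> finite_simple_graph (cycle_graph n)"
  unfolding finite_simple_graph_def cycle_graph_def by auto

end

theory Submission
  imports Defs "HOL-Number_Theory.Fib"
begin

text \<open>
  The barycentric subdivision of \<open>C\<^sub>n\<close> is a cycle of length \<open>2 n\<close>. A prescription is determined by
  the set of incidences at which it equals \<open>-1\<close>, and it is a combinatorial flow iff no two of the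
  corresponding edges of that cycle are adjacent. Hence the flows are counted by the Lucas number
  \<open>L\<^sub>2\<^sub>n = \<phi> ^ (2 n) + \<phi> ^ (-2 n)\<close>, and dividing by \<open>4 ^ n\<close> gives
  \<open>P(C\<^sub>n) = r ^ n + s ^ n\<close> with \<open>r, s = (3 \<plusminus> \<surd>5) / 8\<close>, the roots of \<open>x\<^sup>2 - 3/4 x + 1/16\<close>.
\<close>

section \<open>Counting subsets of a path or a cycle without adjacent points\<close>

text \<open>The forbidden set \<open>X\<close> takes only the values \<open>{}\<close> and
  \<open>{0}\<close>: once the last point of a cycle is chosen, its neighbour \<open>0\<close> must
  be excluded from the remaining path.\<close>

definition sparse_sets :: "nat set \<Rightarrow> nat \<Rightarrow> nat set set" where
  "sparse_sets X m = {S. S \<subseteq> {..<m} - X \<and> (\<forall>i\<in>S. Suc i \<notin> S)}"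

definition cyclic_sparse_sets :: "nat \<Rightarrow> nat set set" where
  "cyclic_sparse_sets m = {S. S \<subseteq> {..<m} \<and> (\<forall>i\<in>S. Suc i mod m \<notin> S)}"

lemma finite_sparse_sets: "finite (sparse_sets X m)"
  by (rule finite_subset[of _ "Pow {..<m}"]) (auto simp: sparse_sets_def)

text \<open>Used to split a family of sets by whether they contain \<open>x\<close>: inserting
  \<open>x\<close> is injective on sets that lack it, and the two parts are disjoint.\<close>

lemma card_Un_insert_image:
  assumes "finite A" "finite B" "\<And>S. S \<in> A \<union> B \<Longrightarrow> x \<notin> S"
  shows "card (A \<union> insert x ` B) = card A + card B"
proof -
  have "inj_on (insert x) B"
    using assms(3) by (intro inj_onI) (metis UnCI insert_ident)
  moreover have "A \<inter> insert x ` B = {}"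
    using assms(3) by auto
  ultimately show ?thesis
    using assms(1,2) by (simp add: card_Un_disjoint card_image)
qed

text \<open>Case split on the last point \<open>Suc m\<close>. If it is chosen, then
  \<open>m\<close> is excluded and the rest lies below \<open>m\<close>; otherwise only the range
  shrinks by one.\<close>

lemma card_sparse_sets_rec:
  assumes "Suc m \<notin> X"
  shows "card (sparse_sets X (Suc (Suc m))) = card (sparse_sets X (Suc m)) + card (sparse_sets X m)"
proof -
  have "sparse_sets X (Suc (Suc m)) = sparse_sets X (Suc m) \<union> insert (Suc m) ` sparse_sets X m"
    (is "?L = ?R")
  proof
    show "?L \<subseteq> ?R"
    proof
      fix S assume S: "S \<in> ?L"
      show "S \<in> ?R"
      proof (cases "Suc m \<in> S")
        case True
        then have "m \<notin> S"
          using S by (auto simp: sparse_sets_def)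
        then have "S - {Suc m} \<in> sparse_sets X m"
          using S by (force simp: sparse_sets_def less_Suc_eq)
        then show ?thesis
          using True by (metis UnCI image_eqI insert_Diff)
      next
        case False
        then have "S \<in> sparse_sets X (Suc m)"
          using S by (force simp: sparse_sets_def less_Suc_eq)
        then show ?thesis ..
      qed
    qed
    show "?R \<subseteq> ?L"
      using assms by (fastforce simp: sparse_sets_def less_Suc_eq)
  qed
  then show ?thesis
    by (simp only:) (rule card_Un_insert_image, auto simp: finite_sparse_sets, auto simp: sparse_sets_def)
qed

lemma card_sparse_sets: "card (sparse_sets {} m) = fib (Suc (Suc m))"
proof (induction m rule: fib.induct)
  case 1
  have "sparse_sets {} 0 = {{}}"
    by (auto simp: sparse_sets_def)
  then show ?case by simp
next
  case 2
  have "sparse_sets {} (Suc 0) = {{}, {0}}"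
    by (auto simp: sparse_sets_def)
  then show ?case by (simp add: card_insert_if)
next
  case (3 m)
  then show ?case by (simp add: card_sparse_sets_rec)
qed

text \<open>Without \<open>0\<close> there remains a path of \<open>m\<close> points, hence the same
  Fibonacci number as for \<open>sparse_sets {} m\<close>.\<close>

lemma card_sparse_sets_avoid_0: "card (sparse_sets {0} (Suc m)) = fib (Suc (Suc m))"
proof (induction m rule: fib.induct)
  case 1
  have "sparse_sets {0} (Suc 0) = {{}}"
    by (auto simp: sparse_sets_def)
  then show ?case by simp
next
  case 2
  have "sparse_sets {0} (Suc (Suc 0)) = {{}, {Suc 0}}"
    by (auto simp: sparse_sets_def less_Suc_eq)
  then show ?case by (simp add: card_insert_if)
next
  case (3 m)
  then show ?case by (simp add: card_sparse_sets_rec[of "Suc m"])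
qed

text \<open>Cut the cycle at its last point \<open>m + 2\<close>. If it is absent, a path of
  \<open>m + 2\<close> points remains; if it is present, both neighbours \<open>0\<close> and
  \<open>m + 1\<close> are excluded and a path of \<open>m\<close> points remains. The sum is the
  Lucas number \<open>L_(m+3)\<close>.\<close>

lemma card_cyclic_sparse_sets:
  "card (cyclic_sparse_sets (m + 3)) = fib (m + 4) + fib (m + 2)"
proof -
  have "cyclic_sparse_sets (m + 3) =
      sparse_sets {} (m + 2) \<union> insert (m + 2) ` sparse_sets {0} (Suc m)" (is "?L = ?R")
  proof
    have succ: "Suc i mod (m + 3) = (if i = m + 2 then 0 else Suc i)" if "i < m + 3" for i
      using that by (auto simp: mod_Suc)
    show "?L \<subseteq> ?R"
    proof
      fix S assume S: "S \<in> ?L"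
      then have lt: "\<And>i. i \<in> S \<Longrightarrow> i < m + 3"
        by (auto simp: cyclic_sparse_sets_def)
      have adj: "(if i = m + 2 then 0 else Suc i) \<notin> S" if "i \<in> S" for i
        using S that succ[OF lt[OF that]] unfolding cyclic_sparse_sets_def by (metis (lifting) mem_Collect_eq)
      \<comment> \<open>For the last point the plain successor \<open>m + 3\<close> is out of range,
        so the uncut condition holds there too.\<close>
      have adj': "Suc i \<notin> S" if "i \<in> S" for i
        using adj[OF that] lt[of "Suc i"] by (auto split: if_splits)
      show "S \<in> ?R"
      proof (cases "m + 2 \<in> S")
        case True
        have "Suc m \<notin> S" "0 \<notin> S"
          using adj[OF True] adj'[of "Suc m"] True by auto
        moreover have "i < Suc m" if "i \<in> S" "i \<noteq> m + 2" for i
          using lt[OF that(1)] that \<open>Suc m \<notin> S\<close> by (cases "i = Suc m") auto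
        ultimately have "S - {m + 2} \<in> sparse_sets {0} (Suc m)"
          using adj' by (auto simp: sparse_sets_def)
        then show ?thesis
          using True by (metis UnCI image_eqI insert_Diff)
      next
        case False
        then have "i < m + 2" if "i \<in> S" for i
          using lt[OF that] that by (cases "i = m + 2") auto
        then show ?thesis
          using adj' by (auto simp: sparse_sets_def)
      qed
    qed
    show "?R \<subseteq> ?L"
    proof
      fix S assume "S \<in> ?R"
      then consider "S \<in> sparse_sets {} (m + 2)"
        | T where "T \<in> sparse_sets {0} (Suc m)" "S = insert (m + 2) T"
        by auto
      then show "S \<in> ?L"
      proof cases
        case 1
        then show ?thesis
          by (force simp: cyclic_sparse_sets_def sparse_sets_def)
      next
        case 2
        then have T: "\<And>i. i \<in> T \<Longrightarrow> 0 < i \<and> i < Suc m \<and> Suc i \<notin> T"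
          by (auto simp: sparse_sets_def)
        then have "Suc i mod (m + 3) \<notin> S" if "i \<in> S" for i
          using that 2(2) succ[of i] by force
        moreover have "S \<subseteq> {..<m + 3}"
          using T 2(2) by force
        ultimately show ?thesis
          by (auto simp: cyclic_sparse_sets_def)
      qed
    qed
  qed
  moreover have "card \<dots> = fib (m + 4) + fib (m + 2)"
    by (subst card_Un_insert_image)
      (auto simp: finite_sparse_sets card_sparse_sets card_sparse_sets_avoid_0 numeral_eq_Suc,
       auto simp: sparse_sets_def)
  ultimately show ?thesis by simp
qed

section \<open>The cycle graph and the cyclic order of its incidences\<close>

text \<open>Indices start at 0 to suit \<open>mod n\<close>, while vertices start at 1, hence the
  outer \<open>Suc\<close>. The index \<open>n - 1\<close> gives the closing edge.\<close>

definition cycle_edge :: "nat \<Rightarrow> nat \<Rightarrow> nat set" where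
  "cycle_edge n k = {Suc k, Suc (Suc k mod n)}"

text \<open>The edges of the barycentric subdivision, in cyclic order starting from \<open>v\<^sub>1\<close>.\<close>

definition cycle_incidence :: "nat \<Rightarrow> nat \<Rightarrow> nat \<times> nat set" where
  "cycle_incidence n j = (Suc (Suc j div 2 mod n), cycle_edge n (j div 2))"

lemma edges_cycle_graph:
  assumes "n \<ge> 1"
  shows "edges (cycle_graph n) = cycle_edge n ` {..<n}"
proof -
  have "cycle_edge n k \<in> edges (cycle_graph n)" if "k < n" for k
  proof (cases "Suc k = n")
    case False
    then show ?thesis
      using that by (auto simp: cycle_graph_def cycle_edge_def intro!: exI[of _ "Suc k"])
  qed (auto simp: cycle_graph_def cycle_edge_def)
  moreover have "{i, i + 1} \<in> cycle_edge n ` {..<n}" if "1 \<le> i" "i < n" for i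
    using that by (intro image_eqI[of _ _ "i - 1"]) (auto simp: cycle_edge_def)
  moreover have "{n, 1} \<in> cycle_edge n ` {..<n}"
    using assms by (intro image_eqI[of _ _ "n - 1"]) (auto simp: cycle_edge_def)
  ultimately show ?thesis
    by (auto simp: cycle_graph_def)
qed

text \<open>Two equal edges with different indices would have swapped endpoints, which forces
  \<open>k = k + 2\<close> modulo \<open>n\<close>; this is impossible for
  \<open>n \<ge> 3\<close>.\<close>

lemma inj_on_cycle_edge:
  assumes "n \<ge> 3"
  shows "inj_on (cycle_edge n) {..<n}"
proof (rule inj_onI)
  fix k l assume kl: "k \<in> {..<n}" "l \<in> {..<n}" and eq: "cycle_edge n k = cycle_edge n l"
  have succ: "Suc i mod n = (if Suc i = n then 0 else Suc i)" if "i < n" for i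
    using that by auto
  show "k = l"
    using eq kl assms succ[of k] succ[of l]
    by (auto simp: cycle_edge_def doubleton_eq_iff split: if_splits)
qed

lemma card_edges_cycle_graph: "n \<ge> 3 \<Longrightarrow> card (edges (cycle_graph n)) = n"
  by (simp add: edges_cycle_graph card_image inj_on_cycle_edge)

text \<open>Positions \<open>2 * k\<close> and \<open>2 * k + 1\<close> carry the two endpoints of
  edge \<open>k\<close>. The edge thus recovers \<open>j div 2\<close> and the vertex recovers the
  parity of \<open>j\<close>; surjectivity follows by counting.\<close>

lemma bij_betw_cycle_incidence:
  assumes "n \<ge> 3"
  shows "bij_betw (cycle_incidence n) {..<2 * n} (incidences (cycle_graph n))"
proof -
  have inj: "inj_on (cycle_incidence n) {..<2 * n}"
  proof (rule inj_onI)
    fix i j assume ij: "i \<in> {..<2 * n}" "j \<in> {..<2 * n}"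
      and eq: "cycle_incidence n i = cycle_incidence n j"
    define k where "k = i div 2"
    have k: "k < n" "j div 2 = k"
      using ij eq inj_on_cycle_edge[OF assms]
      by (auto simp: k_def cycle_incidence_def inj_on_def)
    have vert: "Suc i div 2 mod n = Suc j div 2 mod n"
      using eq by (simp add: cycle_incidence_def)
    have "i = 2 * k \<or> i = Suc (2 * k)" "j = 2 * k \<or> j = Suc (2 * k)"
      using k by (auto simp: k_def)
    \<comment> \<open>The endpoints of edge \<open>k\<close> differ, which separates the even from
      the odd position.\<close>
    moreover have "k mod n \<noteq> Suc k mod n"
      using assms k(1) by (cases "Suc k = n") auto
    ultimately show "i = j"
      using vert by auto
  qed
  have "cycle_incidence n j \<in> incidences (cycle_graph n)" if "j < 2 * n" for j
  proof -
    have "j div 2 < n"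
      using that by simp
    moreover have "Suc j div 2 = j div 2 \<or> Suc j div 2 = Suc (j div 2)"
      by presburger
    ultimately have "Suc (Suc j div 2 mod n) \<in> cycle_edge n (j div 2)"
      by (auto simp: cycle_edge_def)
    moreover have "Suc (Suc j div 2 mod n) \<in> verts (cycle_graph n)"
      using assms by (auto simp: cycle_graph_def Suc_le_eq)
    moreover have "cycle_edge n (j div 2) \<in> edges (cycle_graph n)"
      using assms \<open>j div 2 < n\<close> by (simp add: edges_cycle_graph)
    ultimately show ?thesis
      by (simp add: incidences_def cycle_incidence_def)
  qed
  then have sub: "cycle_incidence n ` {..<2 * n} \<subseteq> incidences (cycle_graph n)"
    by auto
  have "card (cycle_incidence n ` {..<2 * n}) = card (incidences (cycle_graph n))"
    using incidences_card(2)[OF finite_simple_cycle_graph[OF assms]] assms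
    by (simp add: card_image inj card_edges_cycle_graph)
  then have "cycle_incidence n ` {..<2 * n} = incidences (cycle_graph n)"
    using incidences_card(1)[OF finite_simple_cycle_graph[OF assms]] sub
    by (intro card_subset_eq)
  then show ?thesis
    using inj by (simp add: bij_betw_def)
qed

text \<open>Along the cyclic order, neighbours alternately share an edge (\<open>2 * k\<close> and
  \<open>2 * k + 1\<close>) and a vertex (\<open>2 * k + 1\<close> and its successor), and there are
  no other coincidences.\<close>

lemma cycle_incidence_meet_iff:
  assumes "n \<ge> 3" "i < 2 * n" "j < 2 * n" "i \<noteq> j"
  shows "fst (cycle_incidence n i) = fst (cycle_incidence n j)
       \<or> snd (cycle_incidence n i) = snd (cycle_incidence n j)
     \<longleftrightarrow> j = Suc i mod (2 * n) \<or> i = Suc j mod (2 * n)"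
proof -
  have "snd (cycle_incidence n i) = snd (cycle_incidence n j) \<longleftrightarrow> i div 2 = j div 2"
    using inj_on_cycle_edge[OF assms(1)] assms(2,3) by (auto simp: cycle_incidence_def inj_on_def)
  moreover have vert: "Suc m div 2 mod n = (if Suc m = 2 * n then 0 else Suc m div 2)"
    if "m < 2 * n" for m
    using that by (auto intro!: mod_less)
  moreover have succ: "Suc m mod (2 * n) = (if Suc m = 2 * n then 0 else Suc m)"
    if "m < 2 * n" for m
    using that by auto
  moreover have "(if Suc i = 2 * n then 0 else Suc i div 2) = (if Suc j = 2 * n then 0 else Suc j div 2)
      \<or> i div 2 = j div 2 \<longleftrightarrow>
    j = (if Suc i = 2 * n then 0 else Suc i) \<or> i = (if Suc j = 2 * n then 0 else Suc j)"
  proof -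
    \<comment> \<open>Splitting by parity turns \<open>div 2\<close> into linear arithmetic.\<close>
    obtain a b where "i = 2 * a \<or> i = Suc (2 * a)" "j = 2 * b \<or> j = Suc (2 * b)"
      using oddE evenE by (metis Suc_eq_plus1)
    then show ?thesis
      using assms by (elim disjE) auto
  qed
  ultimately show ?thesis
    using assms(2,3) by (simp only: cycle_incidence_def fst_conv snd_conv nat.inject)
qed

section \<open>Flows as cyclic sparse sets\<close>

text \<open>Merges the two uniqueness clauses into a single pairwise condition on incidences, which
  can be transported along \<open>cycle_incidence\<close>.\<close>

lemma combinatorial_flow_iff_disjoint:
  "combinatorial_flow G \<omega> \<longleftrightarrow>
     (\<forall>x\<in>incidences G. \<forall>y\<in>incidences G. \<omega> x = -1 \<longrightarrow> \<omega> y = -1 \<longrightarrow>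
        fst x = fst y \<or> snd x = snd y \<longrightarrow> x = y)"
  unfolding combinatorial_flow_iff Uniq_def by (fastforce simp: incidences_def)

lemma combinatorial_flow_cycle_graph_iff:
  assumes "n \<ge> 3"
  shows "combinatorial_flow (cycle_graph n) \<omega> \<longleftrightarrow>
    {j. j < 2 * n \<and> \<omega> (cycle_incidence n j) = -1} \<in> cyclic_sparse_sets (2 * n)" (is "_ \<longleftrightarrow> ?S \<in> _")
proof -
  note bij = bij_betw_cycle_incidence[OF assms]
  have neq: "Suc i mod (2 * n) \<noteq> i" if "i < 2 * n" for i
    using that assms by (cases "Suc i = 2 * n") auto
  have "combinatorial_flow (cycle_graph n) \<omega> \<longleftrightarrow>
      (\<forall>i\<in>?S. \<forall>j\<in>?S. fst (cycle_incidence n i) = fst (cycle_incidence n j)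
         \<or> snd (cycle_incidence n i) = snd (cycle_incidence n j) \<longrightarrow> i = j)"
    unfolding combinatorial_flow_iff_disjoint bij_betw_imp_surj_on[OF bij, symmetric]
    using bij_betw_imp_inj_on[OF bij] by (auto simp: inj_on_def)
  also have "\<dots> \<longleftrightarrow> (\<forall>i\<in>?S. \<forall>j\<in>?S. i \<noteq> j \<longrightarrow>
      \<not> (j = Suc i mod (2 * n) \<or> i = Suc j mod (2 * n)))"
    using cycle_incidence_meet_iff[OF assms] by blast
  \<comment> \<open>The guard \<open>i \<noteq> j\<close> disappears because no position is its own
    successor, and exchanging \<open>i\<close> and \<open>j\<close> merges the two
    alternatives.\<close>
  also have "\<dots> \<longleftrightarrow> (\<forall>i\<in>?S. Suc i mod (2 * n) \<notin> ?S)"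
    using neq by blast
  also have "\<dots> \<longleftrightarrow> ?S \<in> cyclic_sparse_sets (2 * n)"
    by (auto simp: cyclic_sparse_sets_def)
  finally show ?thesis .
qed

text \<open>A prescription takes only the values 1 and -1, so the positions of -1 determine it;
  \<open>?f\<close> reads them off and \<open>?g\<close> rebuilds the prescription.\<close>

lemma card_combinatorial_flows_cycle_graph:
  assumes "n \<ge> 3"
  shows "card {\<omega> \<in> orientation_prescriptions (cycle_graph n). combinatorial_flow (cycle_graph n) \<omega>}
    = card (cyclic_sparse_sets (2 * n))"
proof (rule bij_betw_same_card)
  let ?I = "incidences (cycle_graph n)" and ?c = "cycle_incidence n"
  let ?f = "\<lambda>\<omega>. {j. j < 2 * n \<and> \<omega> (?c j) = (-1::int)}"
  \<comment> \<open>The restriction gives \<open>undefined\<close> off the incidences, as membership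
    in the extensional function space demands.\<close>
  let ?g = "\<lambda>S. \<lambda>x\<in>?I. if x \<in> ?c ` S then -1 else (1::int)"
  have surj: "?c ` {..<2 * n} = ?I" and inj: "inj_on ?c {..<2 * n}"
    using bij_betw_cycle_incidence[OF assms] by (auto simp: bij_betw_def)
  have fg: "?f (?g S) = S" if "S \<subseteq> {..<2 * n}" for S
  proof -
    have "?c j \<in> ?c ` S \<longleftrightarrow> j \<in> S" if "j < 2 * n" for j
      using inj \<open>S \<subseteq> {..<2 * n}\<close> that by (intro inj_on_image_mem_iff[OF inj]) auto
    moreover have "?c j \<in> ?I" if "j < 2 * n" for j
      using surj that by blast
    ultimately have "?g S (?c j) = -1 \<longleftrightarrow> j \<in> S" if "j < 2 * n" for j
      using that by (simp only: restrict_apply') simp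
    then show ?thesis
      using that by blast
  qed
  show "bij_betw ?f
    {\<omega> \<in> orientation_prescriptions (cycle_graph n). combinatorial_flow (cycle_graph n) \<omega>}
    (cyclic_sparse_sets (2 * n))"
  proof (rule bij_betw_byWitness[where f' = ?g])
    show "\<forall>\<omega>\<in>{\<omega> \<in> orientation_prescriptions (cycle_graph n).
        combinatorial_flow (cycle_graph n) \<omega>}. ?g (?f \<omega>) = \<omega>"
    proof safe
      fix \<omega> assume \<omega>: "\<omega> \<in> orientation_prescriptions (cycle_graph n)"
      show "?g (?f \<omega>) = \<omega>"
      proof
        fix x
        show "?g (?f \<omega>) x = \<omega> x"
        proof (cases "x \<in> ?I")
          case True
          then obtain j where "j < 2 * n" "x = ?c j"
            unfolding surj[symmetric] by auto
          then have "x \<in> ?c ` ?f \<omega> \<longleftrightarrow> \<omega> x = -1"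
            by auto
          moreover have "\<omega> x = 1 \<or> \<omega> x = -1"
            using \<omega> True by (auto simp: orientation_prescriptions_def)
          ultimately have "(if x \<in> ?c ` ?f \<omega> then -1 else 1) = \<omega> x"
            by presburger
          then show ?thesis
            by (simp only: restrict_apply' True)
        next
          case False
          then have "\<omega> x = undefined"
            using \<omega> unfolding orientation_prescriptions_def by (intro PiE_arb)
          then show ?thesis
            using False by simp
        qed
      qed
    qed
    show "\<forall>S\<in>cyclic_sparse_sets (2 * n). ?f (?g S) = S"
      using fg by (simp add: cyclic_sparse_sets_def)
    show "?f ` {\<omega> \<in> orientation_prescriptions (cycle_graph n).
        combinatorial_flow (cycle_graph n) \<omega>} \<subseteq> cyclic_sparse_sets (2 * n)"
      using combinatorial_flow_cycle_graph_iff[OF assms] by auto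
    have "?g S \<in> orientation_prescriptions (cycle_graph n)" for S
      by (auto simp: orientation_prescriptions_def)
    moreover have "combinatorial_flow (cycle_graph n) (?g S)"
      if "S \<in> cyclic_sparse_sets (2 * n)" for S
      unfolding combinatorial_flow_cycle_graph_iff[OF assms]
      using that fg[of S] by (simp add: cyclic_sparse_sets_def)
    ultimately show "?g ` cyclic_sparse_sets (2 * n) \<subseteq>
        {\<omega> \<in> orientation_prescriptions (cycle_graph n). combinatorial_flow (cycle_graph n) \<omega>}"
      by blast
  qed
qed

section \<open>Recurrence, closed form and limit\<close>

lemma flow_prob_cycle_graph:
  assumes "n \<ge> 3"
  shows "flow_prob (cycle_graph n) = real (fib (2 * n + 1) + fib (2 * n - 1)) / 4 ^ n"
proof -
  have "2 * n = (2 * n - 3) + 3" "2 * n - 3 + 4 = 2 * n + 1" "2 * n - 3 + 2 = 2 * n - 1"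
    using assms by auto
  then have "card (cyclic_sparse_sets (2 * n)) = fib (2 * n + 1) + fib (2 * n - 1)"
    using card_cyclic_sparse_sets[of "2 * n - 3"] by simp
  then show ?thesis
    using assms by (simp add: flow_prob_eq_card finite_simple_cycle_graph
        card_combinatorial_flows_cycle_graph card_edges_cycle_graph)
qed

text \<open>After multiplication by \<open>4 ^ (n + 2)\<close> this is the Lucas identity
  \<open>L_(2n+4) - 3 L_(2n+2) + L_(2n) = 0\<close>, a consequence of the Fibonacci
  recurrence.\<close>

lemma flow_prob_cycle_graph_recurrence:
  assumes "n \<ge> 3"
  shows "flow_prob (cycle_graph (n + 2)) - 3/4 * flow_prob (cycle_graph (n + 1))
    + 1/16 * flow_prob (cycle_graph n) = 0"
proof -
  \<comment> \<open>Writing \<open>n = Suc m\<close> removes the truncated subtraction in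
    \<open>2 * n - 1\<close>.\<close>
  obtain m where m: "n = Suc m"
    using assms by (cases n) auto
  have "2 * n + 1 = 2 * m + 3" "2 * n - 1 = 2 * m + 1"
    "2 * (n + 1) + 1 = 2 * m + 5" "2 * (n + 1) - 1 = 2 * m + 3"
    "2 * (n + 2) + 1 = 2 * m + 7" "2 * (n + 2) - 1 = 2 * m + 5"
    using m by auto
  then show ?thesis
    using assms by (simp add: flow_prob_cycle_graph numeral_eq_Suc field_simps)
qed

lemma flow_prob_cycle_graph_3: "flow_prob (cycle_graph 3) = 9/32"
  by (simp add: flow_prob_cycle_graph numeral_eq_Suc)

lemma flow_prob_cycle_graph_4: "flow_prob (cycle_graph 4) = 47/256"
  by (simp add: flow_prob_cycle_graph numeral_eq_Suc)

lemma flow_prob_cycle_graph_closed_form: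
  assumes "n \<ge> 3"
  shows "flow_prob (cycle_graph n) = ((3 + sqrt 5) / 8) ^ n + ((3 - sqrt 5) / 8) ^ n"
proof -
  define r s :: real where "r = (3 + sqrt 5) / 8" and "s = (3 - sqrt 5) / 8"
  have step: "x ^ (k + 2) = 3/4 * x ^ (k + 1) - 1/16 * x ^ k"
    if "x\<^sup>2 = 3/4 * x - 1/16" for x :: real and k
    unfolding power_add that by (simp add: algebra_simps)
  \<comment> \<open>Reducing the powers modulo the quadratic leaves terms linear in
    \<open>x\<close>, so the initial values depend only on \<open>r + s\<close>.\<close>
  have base: "64 * x ^ 3 = 32 * x - 3" "64 * x ^ 4 = 21 * x - 2"
    if "x\<^sup>2 = 3/4 * x - 1/16" for x :: real
  proof -
    have "16 * x\<^sup>2 = 12 * x - 1"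
      using that by simp
    then show "64 * x ^ 3 = 32 * x - 3" "64 * x ^ 4 = 21 * x - 2"
      by algebra+
  qed
  have r: "r\<^sup>2 = 3/4 * r - 1/16" and s: "s\<^sup>2 = 3/4 * s - 1/16"
    by (simp_all add: r_def s_def power2_eq_square field_simps)
  have rs: "r + s = 3/4"
    by (simp add: r_def s_def field_simps)
  have "flow_prob (cycle_graph (m + 3)) = r ^ (m + 3) + s ^ (m + 3)" for m
  \<comment> \<open>\<open>fib.induct\<close> serves as two-step induction with two base cases, here
    the cycles of length 3 and 4.\<close>
  proof (induction m rule: fib.induct)
    case 1
    show ?case
      using flow_prob_cycle_graph_3 base(1)[OF r] base(1)[OF s] rs by simp
  next
    case 2
    show ?case
      using flow_prob_cycle_graph_4 base(2)[OF r] base(2)[OF s] rs by simp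
  next
    case (3 m)
    show ?case
      using 3 flow_prob_cycle_graph_recurrence[of "m + 3"] step[OF r, of "m + 3"]
        step[OF s, of "m + 3"]
      by (simp add: algebra_simps)
  qed
  from this[of "n - 3"] show ?thesis
    using assms by (simp add: r_def s_def)
qed

text \<open>Factoring out the dominant root gives \<open>ln r + ln (1 + (s / r) ^ n) / n\<close> for
  \<open>n \<ge> 3\<close>, and the second term vanishes in the limit because
  \<open>0 < s < r\<close>.\<close>

lemma flow_entropy_cycle_graph_tendsto:
  "(\<lambda>n. flow_entropy (cycle_graph n)) \<longlonglongrightarrow> ln ((3 + sqrt 5) / 8)"
proof -
  define r s :: real where "r = (3 + sqrt 5) / 8" and "s = (3 - sqrt 5) / 8"
  have "sqrt 5 < 3"
    by (rule real_less_lsqrt) auto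
  then have s: "0 < s" and sr: "s < r"
    by (simp_all add: r_def s_def)
  have "norm (s / r) < 1"
    using s sr by simp
  then have "(\<lambda>n. (s / r) ^ n) \<longlonglongrightarrow> 0"
    by (rule LIMSEQ_power_zero)
  from tendsto_ln[OF tendsto_add[OF tendsto_const[of 1] this]]
  have "(\<lambda>n. ln r + ln (1 + (s / r) ^ n) * (1 / real n)) \<longlonglongrightarrow> ln r + ln (1 + 0) * 0"
    by (intro tendsto_add tendsto_mult tendsto_const lim_1_over_n) simp_all
  then have "(\<lambda>n. ln r + ln (1 + (s / r) ^ n) * (1 / real n)) \<longlonglongrightarrow> ln r"
    by simp
  moreover have "\<forall>\<^sub>F n in sequentially. ln r + ln (1 + (s / r) ^ n) * (1 / real n) = flow_entropy (cycle_graph n)"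
    using eventually_ge_at_top[of 3]
  proof eventually_elim
    case (elim n)
    moreover from this have "edges (cycle_graph n) \<noteq> {}"
      by (simp add: cycle_graph_def)
    moreover have "ln (r ^ n + s ^ n) = real n * ln r + ln (1 + (s / r) ^ n)"
    proof -
      have "r ^ n + s ^ n = r ^ n * (1 + (s / r) ^ n)"
        using s sr by (simp add: power_divide distrib_left)
      then show ?thesis
        using s sr by (simp add: ln_mult_pos ln_realpow add_pos_pos)
    qed
    ultimately show ?case
      unfolding r_def s_def
      by (simp add: field_simps flow_entropy_def flow_prob_cycle_graph_closed_form card_edges_cycle_graph)
  qed
  ultimately show ?thesis
    unfolding r_def by (rule Lim_transform_eventually)
qed

theorem theorem3p5:
  shows "(\<forall>n\<ge>3. flow_prob (cycle_graph (n + 2)) - 3/4 * flow_prob (cycle_graph (n + 1))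
             + 1/16 * flow_prob (cycle_graph n) = 0)
       \<and> flow_prob (cycle_graph 3) = 9/32
       \<and> flow_prob (cycle_graph 4) = 47/256
       \<and> (\<lambda>n. flow_entropy (cycle_graph n)) \<sim>[at_top] (\<lambda>_. ln ((3 + sqrt 5) / 8))"
proof -
  \<comment> \<open>This bound gives \<open>r < 1\<close>, so the limit \<open>ln r\<close> is
    nonzero and convergence yields asymptotic equivalence.\<close>
  have "sqrt 5 < 5"
    by (rule real_less_lsqrt) auto
  then have "ln ((3 + sqrt 5) / 8) < 0"
    by (intro ln_less_zero) (auto intro!: add_pos_nonneg)
  then show ?thesis
    using flow_prob_cycle_graph_recurrence flow_prob_cycle_graph_3 flow_prob_cycle_graph_4
      flow_entropy_cycle_graph_tendsto
    by (auto simp: tendsto_imp_asymp_equiv_const)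
qed

end
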